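(* Let $U\in\mathcal{M}_n(\mathbb{C})$ be a unitary matrix and let $\mathcal{A}\subseteq\mathcal{M}_n(\mathbb{C})$ be a $U$-invariant abelian self-adjoint algebra. Then $\mathcal{A}$ is contained in a $U$-invariant masa $\mathcal{B}\subseteq\mathcal{M}_n(\mathbb{C})$.
   Context: $\mathcal{M}_n(\mathbb{C})$ is the algebra of $n\times n$ complex matrices. A subset $\mathcal{X}\subseteq\mathcal{M}_n(\mathbb{C})$ is $U$-invariant if $U^{-1}XU\in\mathcal{X}$ for every $X\in\mathcal{X}$. A subalgebra is self-adjoint if it is closed under conjugate transpose. A masa is a maximal abelian self-adjoint subalgebra of $\mathcal{M}_n(\mathbb{C})$. *)

theory Defs
  imports "HOL-Analysis.Analysis"
begin

definition conj_transpose :: "complex ^ 'n ^ 'm \<Rightarrow> complex ^ 'm ^ 'n"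
  where "conj_transpose X = map_matrix cnj (transpose X)"

definition unitary :: "complex ^ 'n ^ 'n \<Rightarrow> bool"
  where "unitary U \<longleftrightarrow> conj_transpose U ** U = mat 1 \<and> U ** conj_transpose U = mat 1"

(* The linear structure is the complex one; the library's subspace on this type is only
   real-linear.  A subalgebra is not required to contain the identity matrix. *)
definition subalgebra :: "(complex ^ 'n ^ 'n) set \<Rightarrow> bool"
  where "subalgebra A \<longleftrightarrow>
    0 \<in> A \<and>
    (\<forall>X\<in>A. \<forall>Y\<in>A. X + Y \<in> A) \<and>
    (\<forall>c. \<forall>X\<in>A. map_matrix ((*) c) X \<in> A) \<and>
    (\<forall>X\<in>A. \<forall>Y\<in>A. X ** Y \<in> A)"

definition self_adjoint :: "(complex ^ 'n ^ 'n) set \<Rightarrow> bool"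
  where "self_adjoint A \<longleftrightarrow> (\<forall>X\<in>A. conj_transpose X \<in> A)"

definition abelian :: "(complex ^ 'n ^ 'n) set \<Rightarrow> bool"
  where "abelian A \<longleftrightarrow> (\<forall>X\<in>A. \<forall>Y\<in>A. X ** Y = Y ** X)"

definition abelian_self_adjoint_algebra :: "(complex ^ 'n ^ 'n) set \<Rightarrow> bool"
  where "abelian_self_adjoint_algebra A \<longleftrightarrow> subalgebra A \<and> abelian A \<and> self_adjoint A"

definition masa :: "(complex ^ 'n ^ 'n) set \<Rightarrow> bool"
  where "masa B \<longleftrightarrow> abelian_self_adjoint_algebra B \<and>
    (\<forall>C. abelian_self_adjoint_algebra C \<longrightarrow> B \<subseteq> C \<longrightarrow> C = B)"

definition U_invariant :: "complex ^ 'n ^ 'n \<Rightarrow> (complex ^ 'n ^ 'n) set \<Rightarrow> bool"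
  where "U_invariant U S \<longleftrightarrow> (\<forall>X\<in>S. matrix_inv U ** X ** U \<in> S)"

end

(* Among the U-invariant abelian self-adjoint algebras containing A choose B of maximal dimension.
   The map sending X to U* X U preserves B, hence its commutant B', and it preserves the
   Hilbert-Schmidt inner product, so it maps the orthogonal complement of B in B' to itself.  If
   that complement were nonzero it would contain an eigenvector X.  The eigenvalue has modulus 1, so
   X*X and XX* are fixed Hermitian elements of B', and adjoining either to B stays in the class: by
   maximality both lie in B.  Thus D = X*X - XX* is a Hermitian element of B commuting with X, which
   gives tr D^2 = tr D X*X - tr D XX* = 0 and D = 0.  So X is normal and can itself be adjoined
   to B, hence X lies in B, a contradiction.  Therefore B' is contained in B, and B is a masa. *)

theory Submission
  imports Defs "HOL-Computational_Algebra.Fundamental_Theorem_Algebra"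
begin

section \<open>Eigenvectors in invariant subspaces\<close>

text \<open>Iterates of \<open>T\<close> on \<open>x\<close> outnumber the dimension, so some
  nonzero polynomial \<open>p\<close> has \<open>p(T) x = 0\<close>; splitting off its roots one at
  a time reaches an eigenvector. \<open>scale\<close> is the complex action, and \<open>real\<close>
  ties it to the real one of \<open>euclidean_space\<close>, whose dimension yields the
  dependence.\<close>

lemma eigenvector_in_invariant_subspace:
  fixes scale :: "complex \<Rightarrow> 'a::euclidean_space \<Rightarrow> 'a" and T :: "'a \<Rightarrow> 'a"
  assumes vs: "vector_space scale"
    and real: "\<And>r x. scale (of_real r) x = r *\<^sub>R x"
    and T_add: "\<And>x y. T (x + y) = T x + T y"
    and T_scale: "\<And>c x. T (scale c x) = scale c (T x)"
    and V_add: "\<And>x y. x \<in> V \<Longrightarrow> y \<in> V \<Longrightarrow> x + y \<in> V"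
    and V_scale: "\<And>c x. x \<in> V \<Longrightarrow> scale c x \<in> V"
    and V_T: "\<And>x. x \<in> V \<Longrightarrow> T x \<in> V"
    and x: "x \<in> V" "x \<noteq> 0"
  obtains c y where "y \<in> V" "y \<noteq> 0" "T y = scale c y"
proof -
  interpret C: vector_space scale by (rule vs)
  have T0: "T 0 = 0"
    using T_add[of 0 0] by simp
  have V0: "0 \<in> V"
    using V_scale[OF x(1), of 0] by simp
  \<comment> \<open>\<open>act p\<close> is \<open>p(T) x\<close>, evaluated by Horner's scheme.\<close>
  define act where "act p = fold_coeffs (\<lambda>c y. scale c x + T y) p 0" for p
  have act_0 [simp]: "act 0 = 0"
    by (simp add: act_def)
  have act_pCons [simp]: "act (pCons c p) = scale c x + T (act p)" for c p
    by (cases "c = 0"; cases "p = 0") (simp_all add: act_def T0)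
  have act_add: "act (p + q) = act p + act q" for p q
    by (induction p q rule: poly_induct2) (simp_all add: T_add C.scale_left_distrib ac_simps)
  have act_smult: "act (smult c p) = scale c (act p)" for c p
    by (induction p) (simp_all add: T_scale C.scale_right_distrib)
  have act_diff: "act (p - q) = act p - act q" for p q
    using act_add[of "p - q" q] by simp
  have act_V: "act p \<in> V" for p
    by (induction p) (simp_all add: V0 V_add V_scale V_T x)
  have act_monom: "act (monom c n) = scale c ((T ^^ n) x)" for c n
    by (induction n) (simp_all add: monom_0 monom_Suc T0 T_scale)
  have act_sum: "act (sum f I) = (\<Sum>i\<in>I. act (f i))" for f and I :: "nat set"
    by (induction I rule: infinite_finite_induct) (simp_all add: act_add)
  have "\<exists>p. p \<noteq> 0 \<and> act p = 0"
  \<comment> \<open>Linear dependence concerns a set of vectors, so coinciding iterates are treated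
    separately; there a difference of two monomials annihilates \<open>x\<close>.\<close>
  proof (cases "inj_on (\<lambda>n. (T ^^ n) x) {..DIM('a)}")
    case True
    let ?S = "(\<lambda>n. (T ^^ n) x) ` {..DIM('a)}"
    have "dependent ?S"
      by (rule dependent_biggerset) (simp add: card_image[OF True])
    then obtain u v where "v \<in> ?S" "u v \<noteq> 0" and u: "(\<Sum>v\<in>?S. u v *\<^sub>R v) = 0"
      by (auto simp: real_vector.dependent_finite)
    then obtain m where m: "m \<le> DIM('a)" "u ((T ^^ m) x) \<noteq> 0"
      by auto
    let ?p = "\<Sum>n\<le>DIM('a). monom (complex_of_real (u ((T ^^ n) x))) n"
    have "act ?p = 0"
      using u by (simp add: act_sum act_monom real sum.reindex[OF True])
    moreover have "coeff ?p m \<noteq> 0"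
      using m by (simp add: coeff_sum)
    ultimately show ?thesis
      by (metis coeff_0)
  next
    case False
    then obtain m n where "m \<noteq> n" "(T ^^ m) x = (T ^^ n) x"
      by (auto simp: inj_on_def)
    then have "act (monom 1 m + monom (-1) n) = 0"
      by (simp add: act_add act_monom)
    moreover have "coeff (monom 1 m + monom (-1) n :: complex poly) m \<noteq> 0"
      using \<open>m \<noteq> n\<close> by simp
    ultimately show ?thesis
      by (metis coeff_0)
  qed
  then obtain p where "p \<noteq> 0" "act p = 0"
    by blast
  then have "\<exists>c y. y \<in> V \<and> y \<noteq> 0 \<and> T y = scale c y"
  proof (induction "degree p" arbitrary: p rule: less_induct)
    case less
    have "degree p \<noteq> 0"
    proof
      assume "degree p = 0"
      then obtain a where "p = [:a:]"
        by (rule degree_eq_zeroE)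
      with less.prems x show False
        by (simp add: T0)
    qed
    then have "\<not> constant (poly p)"
      by (simp add: constant_degree)
    then obtain a where "poly p a = 0"
      using fundamental_theorem_of_algebra by auto
    then obtain q where q: "p = [:- a, 1:] * q"
      by (auto simp: poly_eq_0_iff_dvd)
    with less.prems have "q \<noteq> 0"
      by auto
    then have deg: "degree q < degree p"
      by (simp add: q degree_mult_eq del: mult_pCons_left)
    \<comment> \<open>Since \<open>(T - a) q(T) x = 0\<close>, either \<open>act q\<close> is an
      eigenvector for \<open>a\<close>, or it vanishes and induction applies to
      \<open>q\<close>.\<close>
    have "T (act q) = scale a (act q)"
      using less.prems(2) by (simp add: q act_diff act_smult)
    with less.hyps[OF deg \<open>q \<noteq> 0\<close>] act_V show ?case
      by blast
  qed
  with that show thesis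
    by blast
qed

section \<open>Complex scalars, adjoints and the trace inner product\<close>

abbreviation cscale :: "complex \<Rightarrow> complex ^ 'n ^ 'm \<Rightarrow> complex ^ 'n ^ 'm"
  where "cscale c \<equiv> map_matrix ((*) c)"

lemma vector_space_cscale: "vector_space (cscale :: complex \<Rightarrow> complex ^ 'n ^ 'm \<Rightarrow> _)"
  by unfold_locales (simp_all add: map_matrix_def vec_eq_iff algebra_simps)

lemma cscale_of_real: "cscale (of_real r) X = r *\<^sub>R X"
  by (simp add: vec_eq_iff) (simp add: scaleR_conv_of_real)

lemma cscale_mult_left: "cscale c X ** Y = cscale c (X ** Y)"
  by (simp add: map_matrix_def vec_eq_iff matrix_matrix_mult_def sum_distrib_left algebra_simps)

lemma cscale_mult_right: "X ** cscale c Y = cscale c (X ** Y)"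
  by (simp add: map_matrix_def vec_eq_iff matrix_matrix_mult_def sum_distrib_left algebra_simps)

lemma matrix_add_rdistrib: "(X + Y) ** Z = X ** Z + Y ** Z"
  by (simp add: vec_eq_iff matrix_matrix_mult_def sum.distrib algebra_simps)

lemma conj_transpose_simps [simp]:
  "conj_transpose (X + Y) = conj_transpose X + conj_transpose Y"
  "conj_transpose (X - Y) = conj_transpose X - conj_transpose Y"
  "conj_transpose (cscale c X) = cscale (cnj c) (conj_transpose X)"
  "conj_transpose (conj_transpose X) = X"
  "conj_transpose 0 = 0"
  by (simp_all add: conj_transpose_def map_matrix_def transpose_def vec_eq_iff)

lemma conj_transpose_mult [simp]:
  "conj_transpose (X ** Y) = conj_transpose Y ** conj_transpose X"
  by (simp add: conj_transpose_def map_matrix_def transpose_def vec_eq_iff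
      matrix_matrix_mult_def algebra_simps)

lemma commute_conj_transpose:
  assumes "self_adjoint B" "\<And>Y. Y \<in> B \<Longrightarrow> X ** Y = Y ** X" "Y \<in> B"
  shows "conj_transpose X ** Y = Y ** conj_transpose X"
  using assms conj_transpose_mult conj_transpose_simps(4) unfolding self_adjoint_def by metis

text \<open>Connects the Euclidean structure, which supplies orthogonal complements, with the trace
  and its cyclicity.\<close>

lemma inner_matrix_eq_trace: "X \<bullet> Y = Re (trace (X ** conj_transpose Y))"
  for X Y :: "complex ^ 'n ^ 'n"
  by (simp add: inner_vec_def trace_def matrix_matrix_mult_def conj_transpose_def
      map_matrix_def transpose_def inner_complex_def)

lemma unitary_matrix_inv:
  assumes "unitary U"
  shows "matrix_inv U = conj_transpose U"
proof -
  \<comment> \<open>\<open>matrix_inv\<close> chooses some two-sided inverse;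
    \<open>conj_transpose U\<close> witnesses that one exists.\<close>
  have "U ** matrix_inv U = mat 1"
    using assms unfolding unitary_def matrix_inv_def by (metis (mono_tags, lifting) someI)
  then have "conj_transpose U ** (U ** matrix_inv U) = conj_transpose U"
    by simp
  then show ?thesis
    using assms by (simp add: unitary_def matrix_mul_assoc)
qed

section \<open>Conjugation by a unitary matrix\<close>

definition conjugate :: "complex ^ 'n ^ 'n \<Rightarrow> complex ^ 'n ^ 'n \<Rightarrow> complex ^ 'n ^ 'n"
  where "conjugate U X = conj_transpose U ** X ** U"

lemma U_invariant_conjugate:
  "unitary U \<Longrightarrow> U_invariant U B \<longleftrightarrow> (\<forall>X\<in>B. conjugate U X \<in> B)"
  by (simp add: U_invariant_def conjugate_def unitary_matrix_inv)

lemma conjugate_add: "conjugate U (X + Y) = conjugate U X + conjugate U Y"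
  by (simp add: conjugate_def matrix_add_ldistrib matrix_add_rdistrib)

lemma conjugate_0 [simp]: "conjugate U 0 = 0"
  by (simp add: conjugate_def)

lemma conjugate_cscale: "conjugate U (cscale c X) = cscale c (conjugate U X)"
  by (simp add: conjugate_def cscale_mult_left cscale_mult_right)

lemma linear_conjugate: "linear (conjugate U)"
  by (rule linearI) (simp_all add: conjugate_add conjugate_cscale flip: cscale_of_real)

lemma conj_transpose_conjugate:
  "conj_transpose (conjugate U X) = conjugate U (conj_transpose X)"
  by (simp add: conjugate_def matrix_mul_assoc)

lemma conjugate_mult:
  assumes "unitary U"
  shows "conjugate U (X ** Y) = conjugate U X ** conjugate U Y"
proof -
  have "conjugate U X ** conjugate U Y
      = conj_transpose U ** X ** (U ** conj_transpose U) ** Y ** U"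
    by (simp add: conjugate_def matrix_mul_assoc)
  also have "U ** conj_transpose U = mat 1"
    using assms by (simp add: unitary_def)
  finally show ?thesis
    by (simp add: conjugate_def matrix_mul_assoc)
qed

lemma trace_conjugate:
  assumes "unitary U"
  shows "trace (conjugate U X) = trace X"
proof -
  have "trace (conjugate U X) = trace (U ** conj_transpose U ** X)"
    by (metis conjugate_def matrix_mul_assoc trace_mul_sym)
  then show ?thesis
    using assms by (simp add: unitary_def)
qed

lemma inner_conjugate:
  assumes "unitary U"
  shows "conjugate U X \<bullet> conjugate U Y = X \<bullet> Y"
  by (simp add: inner_matrix_eq_trace conj_transpose_conjugate trace_conjugate assms
      flip: conjugate_mult[OF assms])

text \<open>A linear map that preserves the norm has trivial kernel.\<close>

lemma inj_conjugate:
  assumes "unitary U"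
  shows "inj (conjugate U)"
proof (rule injI)
  fix X Y assume "conjugate U X = conjugate U Y"
  then have "conjugate U (X - Y) = 0"
    by (simp add: linear_diff[OF linear_conjugate])
  then show "X = Y"
    using inner_conjugate[OF assms, of "X - Y" "X - Y"] by simp
qed

lemma subspace_subalgebra: "subalgebra B \<Longrightarrow> subspace B"
  unfolding subalgebra_def subspace_def by (metis cscale_of_real)

lemma subalgebra_diff: "subalgebra B \<Longrightarrow> X \<in> B \<Longrightarrow> Y \<in> B \<Longrightarrow> X - Y \<in> B"
  by (rule subspace_diff[OF subspace_subalgebra])

text \<open>An injective linear map preserves dimension, so mapping \<open>B\<close> into itself
  forces onto. This allows elements of \<open>B\<close> to be pulled back along the
  conjugation.\<close>

lemma conjugate_image_eq:
  assumes "unitary U" "subspace B" "\<And>X. X \<in> B \<Longrightarrow> conjugate U X \<in> B"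
  shows "conjugate U ` B = B"
proof (rule subspace_dim_equal)
  show "subspace (conjugate U ` B)"
    by (rule linear_subspace_image[OF linear_conjugate assms(2)])
  show "dim B \<le> dim (conjugate U ` B)"
    using dim_image_eq[OF linear_conjugate, of U B] inj_conjugate[OF assms(1)]
    by (simp add: inj_on_subset)
qed (use assms in auto)

section \<open>Generated algebras\<close>

text \<open>The rules mirror the clauses of \<open>subalgebra\<close>; closure under adjoints and
  conjugation is left to induction from the generators.\<close>

inductive_set generated_algebra :: "(complex ^ 'n ^ 'n) set \<Rightarrow> (complex ^ 'n ^ 'n) set"
  for S where
  zero: "0 \<in> generated_algebra S"
| base: "X \<in> S \<Longrightarrow> X \<in> generated_algebra S"
| add: "X \<in> generated_algebra S \<Longrightarrow> Y \<in> generated_algebra S \<Longrightarrow> X + Y \<in> generated_algebra S"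
| cscale: "X \<in> generated_algebra S \<Longrightarrow> cscale c X \<in> generated_algebra S"
| mult: "X \<in> generated_algebra S \<Longrightarrow> Y \<in> generated_algebra S \<Longrightarrow> X ** Y \<in> generated_algebra S"

lemma subalgebra_generated_algebra: "subalgebra (generated_algebra S)"
  by (simp add: subalgebra_def generated_algebra.intros)

lemma self_adjoint_generated_algebra:
  assumes "\<And>X. X \<in> S \<Longrightarrow> conj_transpose X \<in> generated_algebra S"
  shows "self_adjoint (generated_algebra S)"
proof -
  have "conj_transpose X \<in> generated_algebra S" if "X \<in> generated_algebra S" for X
    using that by induction (simp_all add: assms generated_algebra.intros)
  then show ?thesis
    by (simp add: self_adjoint_def)
qed

lemma U_invariant_generated_algebra:
  assumes U: "unitary U" and "\<And>X. X \<in> S \<Longrightarrow> conjugate U X \<in> generated_algebra S"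
  shows "U_invariant U (generated_algebra S)"
proof -
  have "conjugate U X \<in> generated_algebra S" if "X \<in> generated_algebra S" for X
    using that
    by induction (simp_all add: assms generated_algebra.intros conjugate_add conjugate_cscale
        conjugate_mult)
  then show ?thesis
    by (simp add: U_invariant_conjugate U)
qed

lemma generated_algebra_commute:
  assumes "X \<in> generated_algebra S" "\<And>Z. Z \<in> S \<Longrightarrow> Z ** Y = Y ** Z"
  shows "X ** Y = Y ** X"
  using assms(1)
proof induction
  case (mult X1 X2)
  then show ?case
    by (metis matrix_mul_assoc)
qed (simp_all add: assms(2) matrix_add_ldistrib matrix_add_rdistrib
    cscale_mult_left cscale_mult_right)

lemma abelian_generated_algebra:
  assumes "abelian S"
  shows "abelian (generated_algebra S)"
proof -
  \<comment> \<open>\<open>generated_algebra_commute\<close> is used twice: first against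
    generators, then, with that as its hypothesis, against the whole generated algebra.\<close>
  have "X ** Y = Y ** X" if "X \<in> generated_algebra S" "Y \<in> S" for X Y
    using generated_algebra_commute[OF that(1)] that(2) assms by (simp add: abelian_def)
  then show ?thesis
    unfolding abelian_def by (metis generated_algebra_commute)
qed

section \<open>Adjoining commuting eigenvectors\<close>

definition invariant_algebra :: "complex ^ 'n ^ 'n \<Rightarrow> (complex ^ 'n ^ 'n) set \<Rightarrow> bool"
  where "invariant_algebra U B \<longleftrightarrow> abelian_self_adjoint_algebra B \<and> U_invariant U B"

text \<open>Normality makes \<open>B\<close>, \<open>X\<close> and its adjoint a commuting
  self-adjoint family. Conjugation multiplies \<open>X\<close> by \<open>c\<close> and its adjoint
  by \<open>cnj c\<close>, so the algebra they generate is again invariant.\<close>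

lemma invariant_algebra_adjoin_normal:
  assumes U: "unitary U" and B: "invariant_algebra U B"
    and comm: "\<And>Y. Y \<in> B \<Longrightarrow> X ** Y = Y ** X"
    and normal: "conj_transpose X ** X = X ** conj_transpose X"
    and eigen: "conjugate U X = cscale c X"
  shows "\<exists>C. invariant_algebra U C \<and> B \<subseteq> C \<and> X \<in> C"
proof -
  let ?S = "B \<union> {X, conj_transpose X}"
  have B': "abelian B" "self_adjoint B" "U_invariant U B"
    using B by (auto simp: invariant_algebra_def abelian_self_adjoint_algebra_def)
  have comm': "conj_transpose X ** Y = Y ** conj_transpose X" if "Y \<in> B" for Y
    by (rule commute_conj_transpose[OF B'(2) comm that])
  have "abelian ?S"
    using B'(1) comm comm' normal by (auto simp: abelian_def)
  moreover have "conj_transpose Z \<in> generated_algebra ?S" if "Z \<in> ?S" for Z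
    using that B'(2) by (intro generated_algebra.base) (auto simp: self_adjoint_def)
  moreover have "conjugate U Z \<in> generated_algebra ?S" if "Z \<in> ?S" for Z
  proof -
    have "conjugate U (conj_transpose X) = cscale (cnj c) (conj_transpose X)"
      by (simp add: eigen flip: conj_transpose_conjugate)
    moreover have "cscale d X \<in> generated_algebra ?S"
        "cscale d (conj_transpose X) \<in> generated_algebra ?S" for d
      by (simp_all add: generated_algebra.base generated_algebra.cscale)
    ultimately show ?thesis
      using that B'(3) U eigen
      by (auto simp: U_invariant_conjugate intro: generated_algebra.base)
  qed
  ultimately have "invariant_algebra U (generated_algebra ?S)"
    unfolding invariant_algebra_def abelian_self_adjoint_algebra_def
    by (intro conjI subalgebra_generated_algebra abelian_generated_algebra
        self_adjoint_generated_algebra U_invariant_generated_algebra U)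
  moreover have "?S \<subseteq> generated_algebra ?S"
    by (blast intro: generated_algebra.base)
  ultimately show ?thesis
    by blast
qed

lemma commuting_eigenvector_mem_maximal:
  assumes U: "unitary U" and B: "invariant_algebra U B"
    and max: "\<And>C. invariant_algebra U C \<Longrightarrow> B \<subseteq> C \<Longrightarrow> C = B"
    and comm: "\<And>Y. Y \<in> B \<Longrightarrow> X ** Y = Y ** X"
    and eigen: "conjugate U X = cscale c X"
  shows "X \<in> B"
proof (cases "X = 0")
  case True
  then show ?thesis
    using B
    by (simp add: invariant_algebra_def abelian_self_adjoint_algebra_def subalgebra_def)
next
  case False
  let ?X' = "conj_transpose X"
  interpret C: vector_space "cscale :: complex \<Rightarrow> complex ^ 'n ^ 'n \<Rightarrow> _"
    by (rule vector_space_cscale)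
  have B': "subalgebra B" "self_adjoint B"
    using B by (auto simp: invariant_algebra_def abelian_self_adjoint_algebra_def)
  have eigen': "conjugate U ?X' = cscale (cnj c) ?X'"
    by (simp add: eigen flip: conj_transpose_conjugate)
  have comm': "?X' ** Y = Y ** ?X'" if "Y \<in> B" for Y
    by (rule commute_conj_transpose[OF B'(2) comm that])
  \<comment> \<open>Conjugation is an isometry, so \<open>c\<close> has modulus 1;
    \<open>cnj c * c\<close> is the factor by which it scales both \<open>?X' ** X\<close> and
    \<open>X ** ?X'\<close>.\<close>
  have "cnj c * c = 1"
  proof -
    have "cscale c X \<bullet> cscale c X = X \<bullet> X"
      using inner_conjugate[OF U, of X X] by (simp add: eigen)
    also have "cscale c X \<bullet> cscale c X = (cmod c)\<^sup>2 * (X \<bullet> X)"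
      by (simp add: inner_vec_def sum_distrib_left norm_mult power_mult_distrib
          flip: power2_norm_eq_inner)
    finally have "(cmod c)\<^sup>2 = 1"
      using False by simp
    then show ?thesis
      by (metis complex_norm_square mult.commute of_real_1)
  qed
  \<comment> \<open>A Hermitian matrix is normal and a fixed one has eigenvalue 1, so
    \<open>Z\<close> can be adjoined and maximality applies.\<close>
  have fixed_mem: "Z \<in> B"
    if "conj_transpose Z = Z" "conjugate U Z = Z" "\<And>Y. Y \<in> B \<Longrightarrow> Z ** Y = Y ** Z" for Z
    using invariant_algebra_adjoin_normal[OF U B that(3), of 1] that max by auto
  have "?X' ** X \<in> B"
  proof (rule fixed_mem)
    show "conjugate U (?X' ** X) = ?X' ** X"
      using \<open>cnj c * c = 1\<close>
      by (simp add: conjugate_mult U eigen eigen' cscale_mult_left cscale_mult_right mult.commute)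
    show "?X' ** X ** Y = Y ** (?X' ** X)" if "Y \<in> B" for Y
      using comm[OF that] comm'[OF that] by (metis matrix_mul_assoc)
  qed simp
  moreover have "X ** ?X' \<in> B"
  proof (rule fixed_mem)
    show "conjugate U (X ** ?X') = X ** ?X'"
      using \<open>cnj c * c = 1\<close>
      by (simp add: conjugate_mult U eigen eigen' cscale_mult_left cscale_mult_right mult.commute)
    show "X ** ?X' ** Y = Y ** (X ** ?X')" if "Y \<in> B" for Y
      using comm[OF that] comm'[OF that] by (metis matrix_mul_assoc)
  qed simp
  moreover define D where "D = ?X' ** X - X ** ?X'"
  ultimately have "D \<in> B"
    by (simp add: subalgebra_diff[OF B'(1)])
  have "trace (D ** (X ** ?X')) = trace (D ** (?X' ** X))"
  proof -
    have "trace (D ** (X ** ?X')) = trace (X ** (D ** ?X'))"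
      using comm[OF \<open>D \<in> B\<close>] by (simp add: matrix_mul_assoc)
    also have "\<dots> = trace (D ** ?X' ** X)"
      by (rule trace_mul_sym)
    finally show ?thesis
      by (simp add: matrix_mul_assoc)
  qed
  \<comment> \<open>Expand \<open>D ** (D + X ** ?X')\<close>, whose second factor is
    \<open>?X' ** X\<close>, and take traces.\<close>
  then have "trace (D ** D) = 0"
    using matrix_add_ldistrib[of D D "X ** ?X'"]
    by (simp add: D_def trace_add)
  moreover have "conj_transpose D = D"
    by (simp add: D_def)
  ultimately have "D \<bullet> D = 0"
    by (simp add: inner_matrix_eq_trace)
  then have "?X' ** X = X ** ?X'"
    by (simp add: D_def)
  from invariant_algebra_adjoin_normal[OF U B comm this eigen] show ?thesis
    using max by auto
qed

section \<open>The commutant of a maximal invariant algebra\<close>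

lemma commutant_subset_maximal:
  assumes U: "unitary U" and B: "invariant_algebra U B"
    and max: "\<And>C. invariant_algebra U C \<Longrightarrow> B \<subseteq> C \<Longrightarrow> C = B"
    and comm: "\<And>Y. Y \<in> B \<Longrightarrow> X ** Y = Y ** X"
  shows "X \<in> B"
proof -
  have B': "subalgebra B" "abelian B" "\<And>X. X \<in> B \<Longrightarrow> conjugate U X \<in> B"
    using B U
    by (auto simp: invariant_algebra_def abelian_self_adjoint_algebra_def U_invariant_conjugate)
  have sub: "subspace B"
    by (rule subspace_subalgebra[OF B'(1)])
  have onto: "\<exists>Z\<in>B. Y = conjugate U Z" if "Y \<in> B" for Y
    using conjugate_image_eq[OF U sub B'(3)] that by blast
  \<comment> \<open>The orthogonal complement of \<open>B\<close> inside its commutant.\<close>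
  define V where "V = {Z. (\<forall>Y\<in>B. Z ** Y = Y ** Z) \<and> (\<forall>Y\<in>B. Z \<bullet> Y = 0)}"
  obtain Y Z where YZ: "Y \<in> B" "\<And>W. W \<in> B \<Longrightarrow> orthogonal Z W" "X = Y + Z"
    using orthogonal_subspace_decomp_exists[of B X] sub by (metis span_eq_iff)
  have "Z = 0"
  proof (rule ccontr)
    assume "Z \<noteq> 0"
    \<comment> \<open>\<open>Z\<close> is \<open>X - Y\<close>, and both \<open>X\<close> and
      \<open>Y\<close> commute with \<open>B\<close>, the latter because \<open>B\<close> is
      abelian.\<close>
    have "Z ** W = W ** Z" if "W \<in> B" for W
      using comm[OF that] B'(2) YZ(1) that
      by (simp add: YZ(3) abelian_def matrix_add_ldistrib matrix_add_rdistrib)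
    then have "Z \<in> V"
      using YZ(2) by (simp add: V_def orthogonal_def)
    have "cscale c W \<in> V" if "W \<in> V" for c W
    proof -
      have "cscale c W \<bullet> Y = 0" if "Y \<in> B" for Y
      proof -
        \<comment> \<open>Orthogonality is only real, but the scalar moves to the other side as
          \<open>cnj c\<close> and is absorbed by the complex subspace \<open>B\<close>.\<close>
        have "cscale c W \<bullet> Y = W \<bullet> cscale (cnj c) Y"
          by (simp add: inner_matrix_eq_trace cscale_mult_left cscale_mult_right)
        moreover have "cscale (cnj c) Y \<in> B"
          using that B'(1) by (simp add: subalgebra_def)
        ultimately show ?thesis
          using \<open>W \<in> V\<close> by (simp add: V_def)
      qed
      then show ?thesis
        using that by (simp add: V_def cscale_mult_left cscale_mult_right)
    qed
    moreover have "conjugate U W \<in> V" if "W \<in> V" for W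
    proof -
      \<comment> \<open>Write \<open>Y\<close> as the conjugate of an element of \<open>B\<close>;
        both conditions then reduce to those on \<open>W\<close>.\<close>
      have "conjugate U W ** Y = Y ** conjugate U W \<and> conjugate U W \<bullet> Y = 0" if "Y \<in> B" for Y
        using onto[OF that] \<open>W \<in> V\<close>
        by (auto simp: V_def inner_conjugate U simp flip: conjugate_mult[OF U])
      then show ?thesis
        by (simp add: V_def)
    qed
    moreover have "W + W' \<in> V" if "W \<in> V" "W' \<in> V" for W W'
      using that by (simp add: V_def matrix_add_ldistrib matrix_add_rdistrib inner_add_left)
    ultimately obtain c W where W: "W \<in> V" "W \<noteq> 0" "conjugate U W = cscale c W"
      using eigenvector_in_invariant_subspace[where scale = cscale and T = "conjugate U"
          and V = V and x = Z, OF vector_space_cscale cscale_of_real conjugate_add conjugate_cscale]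
        \<open>Z \<in> V\<close> \<open>Z \<noteq> 0\<close>
      by metis
    then have "W \<in> B"
      using commuting_eigenvector_mem_maximal[OF U B max] by (simp add: V_def)
    \<comment> \<open>\<open>W\<close> lies in \<open>B\<close> and is orthogonal to
      \<open>B\<close>, hence to itself.\<close>
    with W show False
      by (auto simp: V_def)
  qed
  with YZ show ?thesis
    by simp
qed

section \<open>Existence of the invariant masa by maximal dimension\<close>

theorem corollary5:
  fixes U :: "complex ^ 'n ^ 'n" and A :: "(complex ^ 'n ^ 'n) set"
  assumes "unitary U"
    and "abelian_self_adjoint_algebra A"
    and "U_invariant U A"
  shows "\<exists>B. masa B \<and> U_invariant U B \<and> A \<subseteq> B"
proof -
  let ?P = "\<lambda>B. invariant_algebra U B \<and> A \<subseteq> B"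
  have "?P A"
    using assms by (simp add: invariant_algebra_def)
  moreover have "dim B < Suc DIM(complex ^ 'n ^ 'n)" for B :: "(complex ^ 'n ^ 'n) set"
    using dim_subset_UNIV[of B] by simp
  ultimately have "\<exists>B. ?P B \<and> (\<forall>C. ?P C \<longrightarrow> dim C \<le> dim B)"
    by (intro ex_has_greatest_nat[of ?P A dim "Suc DIM(complex ^ 'n ^ 'n)"]) simp_all
  then obtain B where B: "?P B" and greatest: "\<And>C. ?P C \<Longrightarrow> dim C \<le> dim B"
    by blast
  \<comment> \<open>Nested subspaces of equal dimension coincide, so greatest dimension gives
    maximality under inclusion.\<close>
  have max: "C = B" if "invariant_algebra U C" "B \<subseteq> C" for C
    using subspace_dim_equal[of B C] greatest[of C] that B
    by (auto simp: invariant_algebra_def abelian_self_adjoint_algebra_def subspace_subalgebra)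
  \<comment> \<open>\<open>C\<close> is not assumed invariant, so \<open>max\<close> does not apply
    to it; but being abelian and containing \<open>B\<close>, it lies in the commutant of
    \<open>B\<close>.\<close>
  have "C = B" if C: "abelian_self_adjoint_algebra C" "B \<subseteq> C" for C
  proof -
    have "X \<in> B" if "X \<in> C" for X
      using commutant_subset_maximal[OF assms(1) conjunct1[OF B] max, of X] that C
      by (auto simp: abelian_self_adjoint_algebra_def abelian_def)
    with C show ?thesis
      by blast
  qed
  then have "masa B"
    using B by (simp add: masa_def invariant_algebra_def)
  with B show ?thesis
    by (auto simp: invariant_algebra_def)
qed

end
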